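(* Let $n,m$ be arbitrary positive integers and let $k,l\in\{0,1,2,\dots\}$. If $\gcd(n,m)\mid l-k$, then $$\Pi_k(n)\,\Pi_l(m)=\Pi_j(\operatorname{lcm}(n,m)),$$ where $j$ is the unique solution modulo $\operatorname{lcm}(n,m)$ of the system of congruences $j\equiv k \pmod n$, $j\equiv l\pmod m$. If $\gcd(n,m)\nmid l-k$, then $\Pi_k(n)\,\Pi_l(m)=0$.
   Context: $\mathcal{H}$ is the Fock space: a complex Hilbert space with orthonormal basis $\{|r\rangle\}_{r=0}^\infty$ (the number states). $|r\rangle\langle r|$ denotes the orthogonal projection onto the line spanned by $|r\rangle$. For a positive integer $n$ and an integer $j\ge 0$, $\Pi_j(n)$ is the orthogonal projection $$\Pi_j(n)=\sum_{\substack{r\ge 0\\ r\equiv j \ (\mathrm{mod}\ n)}}|r\rangle\langle r|$$ (the sum converging in the strong operator topology). Thus $\Pi_j(n)$ depends only on $j$ modulo $n$, and for $0\le j\le n-1$ it equals $\sum_{q=0}^\infty |nq+j\rangle\langle nq+j|$. *)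

theory Defs
  imports "HOL-Analysis.Analysis" "HOL-Number_Theory.Cong"
begin

text \<open>Complex Hilbert spaces. Completeness is inherited from \<^class>\<open>banach\<close>. The inner product
  is conjugate-linear in its first argument.\<close>

class complex_hilbert = banach +
  fixes scaleC :: "complex \<Rightarrow> 'a \<Rightarrow> 'a"  (infixr "*\<^sub>C" 75)
    and cinner :: "'a \<Rightarrow> 'a \<Rightarrow> complex"
  assumes scaleC_add_right: "a *\<^sub>C (x + y) = a *\<^sub>C x + a *\<^sub>C y"
    and scaleC_add_left: "(a + b) *\<^sub>C x = a *\<^sub>C x + b *\<^sub>C x"
    and scaleC_scaleC: "a *\<^sub>C b *\<^sub>C x = (a * b) *\<^sub>C x"
    and scaleR_scaleC: "r *\<^sub>R x = complex_of_real r *\<^sub>C x"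
    and cinner_commute: "cinner x y = cnj (cinner y x)"
    and cinner_add_right: "cinner x (y + z) = cinner x y + cinner x z"
    and cinner_scaleC_right: "cinner x (a *\<^sub>C y) = a * cinner x y"
    and cinner_norm: "cinner x x = complex_of_real ((norm x)\<^sup>2)"

lemma module_scaleC: "module (scaleC :: complex \<Rightarrow> 'a::complex_hilbert \<Rightarrow> 'a)"
proof
  fix x :: 'a
  show "1 *\<^sub>C x = x" using scaleR_scaleC[of 1 x] by simp
qed (simp_all add: scaleC_add_right scaleC_add_left scaleC_scaleC)

definition is_onb :: "(nat \<Rightarrow> 'a::complex_hilbert) \<Rightarrow> bool" where
  "is_onb ket \<longleftrightarrow>
     (\<forall>r s. cinner (ket r) (ket s) = (if r = s then 1 else 0)) \<and>
     closure (module.span scaleC (range ket)) = UNIV"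

text \<open>The rank-one operator \<open>|v\<rangle>\<langle>v|\<close>; for a unit vector it is the orthogonal projection
  onto the line spanned by \<open>v\<close>.\<close>

definition rank_one :: "'a::complex_hilbert \<Rightarrow> 'a \<Rightarrow> 'a" where
  "rank_one v x = cinner v x *\<^sub>C v"

text \<open>Convergence in the strong operator topology is pointwise norm convergence, so the sum is
  taken at each vector; \<open>rank_one_summable\<close> below shows that it converges.\<close>

definition Proj :: "(nat \<Rightarrow> 'a::complex_hilbert) \<Rightarrow> nat \<Rightarrow> nat \<Rightarrow> 'a \<Rightarrow> 'a" where
  "Proj ket j n x = (\<Sum>\<^sub>\<infinity>r\<in>{r. [r = j] (mod n)}. rank_one (ket r) x)"

lemma cinner_zero_right [simp]: "cinner x (0::'a::complex_hilbert) = 0"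
  using cinner_add_right[of x 0 0] by simp

lemma cinner_sum_right: "cinner x (sum f F) = (\<Sum>r\<in>F. cinner x (f r))"
  by (induction F rule: infinite_finite_induct) (simp_all add: cinner_add_right)

lemma norm_sum_orthonormal:
  fixes ket :: "nat \<Rightarrow> 'a::complex_hilbert"
  assumes "is_onb ket" "finite F"
  shows "(norm (\<Sum>r\<in>F. c r *\<^sub>C ket r))\<^sup>2 = (\<Sum>r\<in>F. (cmod (c r))\<^sup>2)"
proof -
  let ?y = "\<Sum>r\<in>F. c r *\<^sub>C ket r"
  have on: "cinner (ket s) (ket r) = (if s = r then 1 else 0)" for r s
    using assms(1) by (auto simp: is_onb_def)
  have 1: "cinner (ket s) ?y = c s" if "s \<in> F" for s
    using that assms(2)
    by (simp add: cinner_sum_right cinner_scaleC_right on if_distrib cong: if_cong)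
  have "cinner ?y ?y = (\<Sum>s\<in>F. c s * cinner ?y (ket s))"
    by (subst (2) sum.cong[OF refl refl]) (simp add: cinner_sum_right cinner_scaleC_right)
  also have "\<dots> = (\<Sum>s\<in>F. c s * cnj (c s))"
    by (intro sum.cong refl) (subst cinner_commute, simp add: 1)
  also have "\<dots> = complex_of_real (\<Sum>s\<in>F. (cmod (c s))\<^sup>2)"
    by (simp only: of_real_sum complex_norm_square)
  finally show ?thesis
    unfolding cinner_norm of_real_eq_iff .
qed

lemma bessel:
  fixes ket :: "nat \<Rightarrow> 'a::complex_hilbert"
  assumes "is_onb ket" "finite F"
  shows "(\<Sum>r\<in>F. (cmod (cinner (ket r) x))\<^sup>2) \<le> (norm x)\<^sup>2"
proof -
  let ?y = "\<Sum>r\<in>F. cinner (ket r) x *\<^sub>C ket r"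
  let ?S = "\<Sum>r\<in>F. (cmod (cinner (ket r) x))\<^sup>2"
  define z where "z = x - ?y"
  have x: "x = z + ?y" by (simp add: z_def)
  have xy: "cinner x ?y = complex_of_real ?S"
  proof -
    have "cinner x ?y = (\<Sum>r\<in>F. cinner (ket r) x * cnj (cinner (ket r) x))"
      unfolding cinner_sum_right cinner_scaleC_right
      by (intro sum.cong refl) (subst (2) cinner_commute, simp)
    then show ?thesis by (simp only: of_real_sum complex_norm_square)
  qed
  have yx: "cinner ?y x = complex_of_real ?S"
    by (subst cinner_commute) (simp add: xy)
  have yy: "cinner ?y ?y = complex_of_real ?S"
    unfolding cinner_norm by (subst norm_sum_orthonormal[OF assms]) simp
  have yz: "cinner ?y z = 0"
    using yx yy cinner_add_right[of ?y z ?y] x by simp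
  have zy: "cinner z ?y = 0"
    by (subst cinner_commute) (simp add: yz)
  have "cinner x x = cinner x z + cinner x ?y"
    using cinner_add_right[of x z ?y] x by simp
  moreover have "cinner x z = cinner z z"
  proof -
    have "cinner x z = cnj (cinner z x)" by (rule cinner_commute)
    also have "cinner z x = cinner z z + cinner z ?y"
      using cinner_add_right[of z z ?y] x by simp
    finally show ?thesis using zy cinner_norm[of z] by simp
  qed
  ultimately have "complex_of_real ((norm x)\<^sup>2) = complex_of_real ((norm z)\<^sup>2 + ?S)"
    by (simp only: xy cinner_norm of_real_add)
  then have "(norm x)\<^sup>2 = (norm z)\<^sup>2 + ?S"
    unfolding of_real_eq_iff .
  then show ?thesis by simp
qed

lemma rank_one_summable:
  fixes ket :: "nat \<Rightarrow> 'a::complex_hilbert"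
  assumes "is_onb ket"
  shows "(\<lambda>r. rank_one (ket r) x) summable_on A"
proof -
  let ?c = "\<lambda>r. (cmod (cinner (ket r) x))\<^sup>2"
  let ?f = "\<lambda>r. rank_one (ket r) x"
  have "?c summable_on A"
    by (rule nonneg_bdd_above_summable_on)
       (auto intro!: bdd_aboveI[of _ "(norm x)\<^sup>2"] bessel[OF assms])
  then obtain L where L: "(sum ?c \<longlongrightarrow> L) (finite_subsets_at_top A)"
    unfolding summable_on_def has_sum_def by blast
  have "\<exists>P. eventually P (finite_subsets_at_top A) \<and>
          (\<forall>F G. P F \<and> P G \<longrightarrow> dist (sum ?f F) (sum ?f G) < e)" if "e > 0" for e
  proof -
    define d where "d = e\<^sup>2 / 8"
    have "d > 0" using that by (simp add: d_def)
    then have "\<forall>\<^sub>F F in finite_subsets_at_top A. dist (sum ?c F) L < d"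
      using L by (simp add: tendsto_iff)
    then obtain F0 where F0: "finite F0" "F0 \<subseteq> A"
        "\<And>F. finite F \<Longrightarrow> F0 \<subseteq> F \<Longrightarrow> F \<subseteq> A \<Longrightarrow> dist (sum ?c F) L < d"
      unfolding eventually_finite_subsets_at_top by meson
    define P where "P F \<longleftrightarrow> finite F \<and> F0 \<subseteq> F \<and> F \<subseteq> A" for F
    have "eventually P (finite_subsets_at_top A)"
      unfolding eventually_finite_subsets_at_top P_def using F0(1,2)
      by (intro exI[of _ F0]) simp
    moreover have "dist (sum ?f F) (sum ?f G) < e" if FG: "P F" "P G" for F G
    proof -
      have half: "dist (sum ?f (F \<union> G)) (sum ?f H) < e / 2" if H: "P H" "H \<subseteq> F \<union> G" for H
      proof -
        have fin: "finite (F \<union> G)" using FG by (simp add: P_def)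
        have "(dist (sum ?f (F \<union> G)) (sum ?f H))\<^sup>2 = (norm (sum ?f ((F \<union> G) - H)))\<^sup>2"
          using fin H by (simp add: dist_norm sum_diff)
        also have "\<dots> = sum ?c ((F \<union> G) - H)"
          unfolding rank_one_def using fin by (intro norm_sum_orthonormal[OF assms]) simp
        also have "\<dots> = sum ?c (F \<union> G) - sum ?c H"
          using fin H by (simp add: sum_diff)
        also have "\<dots> < 2 * d"
        proof -
          have "dist (sum ?c (F \<union> G)) L < d" and "dist (sum ?c H) L < d"
            using FG H by (intro F0(3); auto simp: P_def)+
          then show ?thesis by (simp add: dist_real_def)
        qed
        also have "\<dots> = (e / 2)\<^sup>2" by (simp add: d_def power_divide)
        finally show ?thesis
          by (rule power_less_imp_less_base) (use \<open>e > 0\<close> in simp)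
      qed
      show ?thesis
        using half[of F] half[of G] FG
          dist_triangle3[of "sum ?f F" "sum ?f G" "sum ?f (F \<union> G)"] by simp
    qed
    ultimately show ?thesis by blast
  qed
  then have "cauchy_filter (filtermap (sum ?f) (finite_subsets_at_top A))"
    by (simp add: cauchy_filter_metric_filtermap)
  moreover have "complete (UNIV :: 'a set)"
    by (meson Cauchy_convergent UNIV_I complete_def convergent_def)
  ultimately obtain y where "(sum ?f \<longlongrightarrow> y) (finite_subsets_at_top A)"
    using complete_uniform[where S = UNIV] by (force simp add: filterlim_def)
  then show ?thesis
    unfolding summable_on_def has_sum_def by blast
qed

end

theory Submission
  imports Defs
begin

text \<open>Every \<open>Proj ket j n\<close> is diagonal in the number basis: it keeps the
  coefficient at \<open>ket s\<close> if s lies in the class of j mod n and kills it otherwise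
  (\<open>cinner_ket_Proj\<close>). A product of two such operators therefore sums the
  \<open>rank_one (ket r)\<close> over the intersection of the two residue classes
  (\<open>Proj_Proj\<close>). What remains is the Chinese remainder theorem for moduli that need not
  be coprime: the intersection is a single class mod \<open>lcm n m\<close> if the gcd divides l -
  k, and empty otherwise.\<close>

lemma scaleC_zero_left: "0 *\<^sub>C (x :: 'a::complex_hilbert) = 0"
  using scaleR_scaleC[of 0 x] by simp

text \<open>Continuity is what lets the inner product pass through the infinite sum in
  \<open>Proj\<close>. The bound is Bessel's inequality for a single basis vector.\<close>

lemma bounded_linear_cinner_ket:
  fixes ket :: "nat \<Rightarrow> 'a::complex_hilbert"
  assumes "is_onb ket"
  shows "bounded_linear (cinner (ket s))"
proof (rule bounded_linear_intro)
  fix x :: 'a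
  have "(cmod (cinner (ket s) x))\<^sup>2 \<le> (norm x)\<^sup>2"
    using bessel[OF assms, of "{s}" x] by simp
  then show "norm (cinner (ket s) x) \<le> norm x * 1"
    by (simp add: power2_le_iff_abs_le)
qed (simp_all add: cinner_add_right scaleR_scaleC cinner_scaleC_right scaleR_conv_of_real)

lemma cinner_ket_Proj:
  fixes ket :: "nat \<Rightarrow> 'a::complex_hilbert"
  assumes "is_onb ket"
  shows "cinner (ket s) (Proj ket j n x) = (if [s = j] (mod n) then cinner (ket s) x else 0)"
proof -
  let ?A = "{r. [r = j] (mod n)}"
  have on: "cinner (ket s) (rank_one (ket r) x) = (if r = s then cinner (ket s) x else 0)" for r
    using assms by (simp add: is_onb_def rank_one_def cinner_scaleC_right)
  have "cinner (ket s) (Proj ket j n x) = (\<Sum>\<^sub>\<infinity>r\<in>?A. cinner (ket s) (rank_one (ket r) x))"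
    unfolding Proj_def
    by (rule infsumI[symmetric, OF has_sum_bounded_linear[OF bounded_linear_cinner_ket[OF assms]
          has_sum_infsum[OF rank_one_summable[OF assms]]]])
  \<comment> \<open>By orthonormality only the summand r = s can survive.\<close>
  also have "\<dots> = (\<Sum>\<^sub>\<infinity>r\<in>?A \<inter> {s}. cinner (ket s) x)"
    unfolding on by (rule infsum_cong_neutral) auto
  also have "\<dots> = (if [s = j] (mod n) then cinner (ket s) x else 0)"
    by auto
  finally show ?thesis .
qed

lemma Proj_Proj:
  fixes ket :: "nat \<Rightarrow> 'a::complex_hilbert"
  assumes "is_onb ket"
  shows "Proj ket k n (Proj ket l m x) =
    (\<Sum>\<^sub>\<infinity>r\<in>{r. [r = k] (mod n) \<and> [r = l] (mod m)}. rank_one (ket r) x)"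
  \<comment> \<open>Only the outer projection is expanded; the inner one enters through its
    coefficients, which vanish off the class of l mod m.\<close>
  unfolding Proj_def[of ket k n] rank_one_def cinner_ket_Proj[OF assms]
  by (rule infsum_cong_neutral) (auto simp: scaleC_zero_left)

lemma cong_lcm_nat_iff: "[a = b] (mod lcm n m) \<longleftrightarrow> [a = b] (mod n) \<and> [a = b] (mod m)"
  for a b n m :: nat
  using cong_cong_lcm_nat cong_dvd_modulus_nat dvd_lcm1 dvd_lcm2 by blast

text \<open>Both congruences descend to the modulus \<open>gcd n m\<close>, where j can be
  eliminated.\<close>

lemma gcd_dvd_if_simultaneous_cong:
  fixes j k l n m :: nat
  assumes "[j = k] (mod n)" "[j = l] (mod m)"
  shows "int (gcd n m) dvd int l - int k"
proof -
  have "int (gcd n m) dvd int j - int k" "int (gcd n m) dvd int j - int l"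
    using assms by (auto simp flip: cong_int_iff simp: cong_iff_dvd_diff intro: dvd_trans[rotated])
  then have "int (gcd n m) dvd (int j - int k) - (int j - int l)"
    by (rule dvd_diff)
  then show ?thesis
    by simp
qed

lemma ex_simultaneous_cong_nat:
  fixes k l n m :: nat
  assumes "int (gcd n m) dvd int l - int k" "n > 0" "m > 0"
  obtains j where "j < lcm n m" "[j = k] (mod n)" "[j = l] (mod m)"
proof -
  obtain c where c: "int l - int k = int (gcd n m) * c"
    using assms(1) by auto
  obtain x where x: "[int n * x = gcd (int n) (int m)] (mod int m)"
    using cong_solve_int by blast
  \<comment> \<open>By Bezout, n * x is the gcd mod m. Adding n * x * c to k thus changes nothing
    mod n and adds l - k mod m.\<close>
  define y where "y = int k + int n * x * c"
  have yk: "[y = int k] (mod int n)"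
    by (simp add: y_def cong_iff_dvd_diff)
  have "[y = int k + int (gcd n m) * c] (mod int m)"
    unfolding y_def using x by (intro cong_add cong_mult cong_refl) (simp)
  then have yl: "[y = int l] (mod int m)"
    using c by (simp add: algebra_simps)
  \<comment> \<open>The Bezout coefficient x and the quotient c may be negative, so the solution is
    built in the integers. Reducing by the positive lcm makes it nonnegative, and \<open>nat\<close>
    loses nothing.\<close>
  define j where "j = nat (y mod int (lcm n m))"
  have pos: "int (lcm n m) > 0"
    using assms(2,3) by (simp add: lcm_pos_nat)
  have ij: "int j = y mod int (lcm n m)"
    using pos by (simp add: j_def)
  have "[int j = y] (mod int (lcm n m))"
    by (simp add: ij)
  then have "[int j = y] (mod int n)" "[int j = y] (mod int m)"
    by (auto intro: cong_dvd_modulus)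
  then have "[j = k] (mod n)" "[j = l] (mod m)"
    using yk yl cong_trans by (auto simp flip: cong_int_iff)
  moreover have "j < lcm n m"
    using pos pos_mod_bound[OF pos, of y] by (simp flip: ij)
  ultimately show thesis
    using that by blast
qed

theorem theorem1:
  fixes ket :: "nat \<Rightarrow> 'a::complex_hilbert"
    and n m k l :: nat
  assumes "is_onb ket" and "n > 0" and "m > 0"
  shows "(int (gcd n m) dvd int l - int k \<longrightarrow>
            (\<exists>!j. j < lcm n m \<and> [j = k] (mod n) \<and> [j = l] (mod m)) \<and>
            (\<forall>j. [j = k] (mod n) \<and> [j = l] (mod m) \<longrightarrow>
                 Proj ket k n \<circ> Proj ket l m = Proj ket j (lcm n m))) \<and>
         (\<not> int (gcd n m) dvd int l - int k \<longrightarrow>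
            Proj ket k n \<circ> Proj ket l m = (\<lambda>x. 0))"
proof (intro conjI impI allI)
  assume "int (gcd n m) dvd int l - int k"
  then obtain j where j: "j < lcm n m" "[j = k] (mod n)" "[j = l] (mod m)"
    using ex_simultaneous_cong_nat assms(2,3) by blast
  have "i = j" if "i < lcm n m" "[i = k] (mod n)" "[i = l] (mod m)" for i
  proof -
    have "[i = j] (mod lcm n m)"
      unfolding cong_lcm_nat_iff using that j cong_trans cong_sym by blast
    then show ?thesis
      using that(1) j(1) cong_less_modulus_unique_nat by blast
  qed
  then show "\<exists>!j. j < lcm n m \<and> [j = k] (mod n) \<and> [j = l] (mod m)"
    using j by blast
next
  fix j
  assume j: "[j = k] (mod n) \<and> [j = l] (mod m)"
  \<comment> \<open>Any common solution j serves as representative, since k and l may be replaced by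
    j in the two congruences.\<close>
  have "{r. [r = k] (mod n) \<and> [r = l] (mod m)} = {r. [r = j] (mod lcm n m)}"
    unfolding cong_lcm_nat_iff using j cong_trans cong_sym by blast
  then show "Proj ket k n \<circ> Proj ket l m = Proj ket j (lcm n m)"
    by (simp add: fun_eq_iff Proj_Proj[OF assms(1)] Proj_def[of ket j])
next
  assume "\<not> int (gcd n m) dvd int l - int k"
  then have "{r. [r = k] (mod n) \<and> [r = l] (mod m)} = {}"
    using gcd_dvd_if_simultaneous_cong by blast
  then show "Proj ket k n \<circ> Proj ket l m = (\<lambda>x. 0)"
    by (simp only: fun_eq_iff o_apply Proj_Proj[OF assms(1)] infsum_empty simp_thms)
qed

end
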